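(* Let $\{u=F(x,y),\ v=G(x,y)\}\subset\mathbb{R}^4$ be a real-analytic surface germ at the origin with $F=F_2+O(3)$, $G=G_2+O(3)$, whose quadratic parts $F_2,G_2$ are linearly dependent (the parallel case). Then, through an invertible linear transformation of $\mathbb{R}^4$, the germ can be brought to one of the following four forms at order 2: $$\textbf{(2a)}\quad u=0+O_{x,y}(3),\quad v=0+O_{x,y}(3);$$ $$\textbf{(2b)}\quad u=x^2+O_{x,y}(3),\quad v=0+O_{x,y}(3);$$ $$\textbf{(2c)}\quad u=xy+O_{x,y}(3),\quad v=0+O_{x,y}(3);$$ $$\textbf{(2d)}\quad u=x^2+y^2+O_{x,y}(3),\quad v=0+O_{x,y}(3).$$ Moreover these four forms are pairwise nonequivalent: no affine transformation of $\mathbb{R}^4$ fixing the origin maps a germ of one of these four forms to a germ of another one.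
   Context: Surfaces are germs at the origin of real-analytic graphs over the $(x,y)$-plane in $\mathbb{R}^4\ni(x,y,u,v)$, and equivalences are affine transformations of $\mathbb{R}^4$ fixing the origin (i.e. elements of $\mathrm{GL}(4,\mathbb{R})$) mapping one germ to the other. $O_{x,y}(k)$ denotes a convergent power series all of whose monomials have total degree at least $k$. $F_2=F_{2,0}x^2+F_{1,1}xy+F_{0,2}y^2$ and $G_2=G_{2,0}x^2+G_{1,1}xy+G_{0,2}y^2$ are the homogeneous quadratic parts. *)

theory Defs
  imports "HOL-Analysis.Analysis"
begin

text \<open>
  Functions on the plane are total; only their germ at the origin matters, since
  the definitions of order and of germ equality below look at a neighbourhood of 0 only.
  \<open>order_ge k\<close> is the class \<open>O\<^sub>x\<^sub>,\<^sub>y(k)\<close>: sums, near the origin, of a convergent double power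
  series without monomials of total degree below \<open>k\<close>.
\<close>

definition order_ge :: "nat \<Rightarrow> (real \<Rightarrow> real \<Rightarrow> real) set" where
  "order_ge k = {R. \<exists>c :: nat \<Rightarrow> nat \<Rightarrow> real.
     (\<forall>i j. i + j < k \<longrightarrow> c i j = 0) \<and>
     (\<exists>r>0. \<forall>x y. \<bar>x\<bar> < r \<longrightarrow> \<bar>y\<bar> < r \<longrightarrow>
        ((\<lambda>(i, j). c i j * x ^ i * y ^ j) has_sum R x y) UNIV)}"

definition quad_form :: "real \<Rightarrow> real \<Rightarrow> real \<Rightarrow> real \<Rightarrow> real \<Rightarrow> real" where
  "quad_form a b c x y = a * x\<^sup>2 + b * x * y + c * y\<^sup>2"

text \<open>Linear dependence of the pair (not of the set) of functions, so equal functions count as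
  dependent.\<close>

definition lin_dependent_pair :: "(real \<Rightarrow> real \<Rightarrow> real) \<Rightarrow> (real \<Rightarrow> real \<Rightarrow> real) \<Rightarrow> bool" where
  "lin_dependent_pair P Q \<longleftrightarrow>
     (\<exists>\<alpha> \<beta> :: real. (\<alpha>, \<beta>) \<noteq> (0, 0) \<and> (\<forall>x y. \<alpha> * P x y + \<beta> * Q x y = 0))"

text \<open>The coordinates \<open>(x, y, u, v)\<close> of \<open>\<real>\<^sup>4\<close> are the components 1, 2, 3, 4.\<close>

definition surface :: "(real \<Rightarrow> real \<Rightarrow> real) \<Rightarrow> (real \<Rightarrow> real \<Rightarrow> real) \<Rightarrow> (real^4) set" where
  "surface F G = {p. p $ 3 = F (p $ 1) (p $ 2) \<and> p $ 4 = G (p $ 1) (p $ 2)}"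

definition same_germ :: "(real^4) set \<Rightarrow> (real^4) set \<Rightarrow> bool" where
  "same_germ S S' \<longleftrightarrow> (\<forall>\<^sub>F p in nhds 0. p \<in> S \<longleftrightarrow> p \<in> S')"

text \<open>For a homeomorphism \<open>T\<close> fixing the origin, the image of the germ of \<open>S\<close> at 0 is the germ of
  \<open>T ` S\<close> at 0.\<close>

definition maps_germ :: "(real^4 \<Rightarrow> real^4) \<Rightarrow> (real^4) set \<Rightarrow> (real^4) set \<Rightarrow> bool" where
  "maps_germ T S S' \<longleftrightarrow> same_germ (T ` S) S'"

definition affine_transformation :: "(real^4 \<Rightarrow> real^4) \<Rightarrow> bool" where
  "affine_transformation T \<longleftrightarrow>
     (\<exists>(A :: real^4^4) b. invertible A \<and> T = (\<lambda>p. A *v p + b))"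

datatype form = Form2a | Form2b | Form2c | Form2d

fun form_u :: "form \<Rightarrow> real \<Rightarrow> real \<Rightarrow> real" where
  "form_u Form2a x y = 0"
| "form_u Form2b x y = x\<^sup>2"
| "form_u Form2c x y = x * y"
| "form_u Form2d x y = x\<^sup>2 + y\<^sup>2"

definition has_form :: "form \<Rightarrow> (real \<Rightarrow> real \<Rightarrow> real) \<Rightarrow> (real \<Rightarrow> real \<Rightarrow> real) \<Rightarrow> bool" where
  "has_form k F G \<longleftrightarrow> (\<lambda>x y. F x y - form_u k x y) \<in> order_ge 3 \<and> G \<in> order_ge 3"

end

theory Submission
  imports Defs
begin

text \<open>
  Existence: a linear dependency \<open>\<alpha>F\<^sub>2 + \<beta>G\<^sub>2 = 0\<close> says that \<open>\<alpha>u + \<beta>v\<close> has no quadratic part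
  along the surface, so it can serve as the new \<open>v\<close>. The complementary combination \<open>\<beta>u - \<alpha>v\<close> has
  some binary quadratic form as quadratic part, and a linear change of \<open>(x, y)\<close> together with a
  rescaling of \<open>u\<close>, possibly by a negative factor, brings a real binary quadratic form to one of
  \<open>0\<close>, \<open>x\<^sup>2\<close>, \<open>xy\<close>, \<open>x\<^sup>2 + y\<^sup>2\<close> (\<open>quad_form_normal_form\<close>). These changes of coordinates are
  block-diagonal and therefore carry graphs to graphs (\<open>block_change_of_coordinates\<close>). The
  analytic content is that a convergent power series of order at least 3 remains one after a linear
  substitution (\<open>order_ge_linear_subst\<close>), which rests on absolute convergence.

  Nonequivalence: an affine map that fixes the origin is linear. If it maps a germ of one of the
  forms to a germ of another, then it preserves the common tangent plane \<open>u = v = 0\<close>, which makes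
  its matrix block-triangular, and the quadratic part of the source is, up to a nonzero factor, the
  quadratic part of the target composed with an invertible linear map of \<open>(x, y)\<close>
  (\<open>linear_map_between_graphs\<close>). Such a relation preserves whether the form vanishes and the sign
  of its discriminant, and these two invariants separate the four normal forms
  (\<open>normal_forms_inequivalent\<close>).
\<close>

section \<open>Convergent power series of given order\<close>

lemma order_geE:
  assumes "R \<in> order_ge k"
  obtains c r where "\<And>i j. i + j < k \<Longrightarrow> c i j = 0" "r > 0"
    "\<And>x y. \<bar>x\<bar> < r \<Longrightarrow> \<bar>y\<bar> < r \<Longrightarrow> ((\<lambda>(i, j). c i j * x ^ i * y ^ j) has_sum R x y) UNIV"
  using assms unfolding order_ge_def by blast

lemma order_ge_add:
  assumes "R \<in> order_ge k" "S \<in> order_ge k"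
  shows "(\<lambda>x y. R x y + S x y) \<in> order_ge k"
proof -
  obtain c r where c: "\<And>i j. i + j < k \<Longrightarrow> c i j = 0" "r > 0"
    "\<And>x y. \<bar>x\<bar> < r \<Longrightarrow> \<bar>y\<bar> < r \<Longrightarrow> ((\<lambda>(i, j). c i j * x ^ i * y ^ j) has_sum R x y) UNIV"
    using order_geE[OF assms(1)] by blast
  obtain d s where d: "\<And>i j. i + j < k \<Longrightarrow> d i j = 0" "s > 0"
    "\<And>x y. \<bar>x\<bar> < s \<Longrightarrow> \<bar>y\<bar> < s \<Longrightarrow> ((\<lambda>(i, j). d i j * x ^ i * y ^ j) has_sum S x y) UNIV"
    using order_geE[OF assms(2)] by blast
  have "((\<lambda>(i, j). (c i j + d i j) * x ^ i * y ^ j) has_sum (R x y + S x y)) UNIV"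
    if "\<bar>x\<bar> < min r s" "\<bar>y\<bar> < min r s" for x y
    using has_sum_add[OF c(3) d(3), of x y x y] that
    by (simp add: case_prod_unfold algebra_simps)
  then show ?thesis
    unfolding order_ge_def using c(1,2) d(1,2)
    by (intro CollectI exI[of _ "\<lambda>i j. c i j + d i j"] conjI exI[of _ "min r s"]) auto
qed

lemma order_ge_scale:
  assumes "R \<in> order_ge k"
  shows "(\<lambda>x y. m * R x y) \<in> order_ge k"
proof -
  obtain c r where c: "\<And>i j. i + j < k \<Longrightarrow> c i j = 0" "r > 0"
    "\<And>x y. \<bar>x\<bar> < r \<Longrightarrow> \<bar>y\<bar> < r \<Longrightarrow> ((\<lambda>(i, j). c i j * x ^ i * y ^ j) has_sum R x y) UNIV"
    using order_geE[OF assms(1)] by blast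
  have "((\<lambda>(i, j). (m * c i j) * x ^ i * y ^ j) has_sum (m * R x y)) UNIV"
    if "\<bar>x\<bar> < r" "\<bar>y\<bar> < r" for x y
    using has_sum_cmult_right[OF c(3), of x y m] that
    by (simp add: case_prod_unfold algebra_simps)
  then show ?thesis
    unfolding order_ge_def using c(1,2)
    by (intro CollectI exI[of _ "\<lambda>i j. m * c i j"] conjI exI[of _ r]) auto
qed

lemma order_ge_swap:
  assumes "R \<in> order_ge k"
  shows "(\<lambda>x y. R y x) \<in> order_ge k"
proof -
  obtain c r where c: "\<And>i j. i + j < k \<Longrightarrow> c i j = 0" "r > 0"
    "\<And>x y. \<bar>x\<bar> < r \<Longrightarrow> \<bar>y\<bar> < r \<Longrightarrow> ((\<lambda>(i, j). c i j * x ^ i * y ^ j) has_sum R x y) UNIV"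
    using order_geE[OF assms(1)] by blast
  have "((\<lambda>(i, j). c j i * x ^ i * y ^ j) has_sum R y x) UNIV"
    if "\<bar>x\<bar> < r" "\<bar>y\<bar> < r" for x y
  proof -
    have "((\<lambda>(i, j). c j i * x ^ i * y ^ j) has_sum R y x) UNIV \<longleftrightarrow>
          ((\<lambda>(i, j). c i j * y ^ i * x ^ j) has_sum R y x) UNIV"
      by (rule has_sum_reindex_bij_witness[where i = prod.swap and j = prod.swap]) auto
    then show ?thesis using c(3) that by blast
  qed
  then show ?thesis
    unfolding order_ge_def using c(1,2)
    by (intro CollectI exI[of _ "\<lambda>i j. c j i"] conjI exI[of _ r]) (auto simp: add.commute)
qed

text \<open>
  Expanding \<open>(\<alpha>x + \<beta>y)\<^sup>i\<close> by the binomial theorem turns the double series into a series over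
  triples \<open>((i, j), l)\<close> with \<open>l \<le> i\<close>. It converges absolutely, because replacing every term by its
  absolute value amounts to evaluating the original absolute series at
  \<open>(\<bar>\<alpha>x\<bar> + \<bar>\<beta>y\<bar>, \<bar>y\<bar>)\<close>, which still lies in the domain of convergence if \<open>x\<close>, \<open>y\<close> are small.
  So the terms may be regrouped by the monomial \<open>x\<^sup>l y\<^sup>m\<close> they contribute to; only finitely many
  contribute to each, and all of them have \<open>i + j = l + m\<close>, so the order does not drop.
\<close>

lemma order_ge_subst_first:
  assumes "R \<in> order_ge k"
  shows "(\<lambda>x y. R (\<alpha> * x + \<beta> * y) y) \<in> order_ge k"
proof -
  obtain c r where c: "\<And>i j. i + j < k \<Longrightarrow> c i j = 0" "r > 0"
    "\<And>x y. \<bar>x\<bar> < r \<Longrightarrow> \<bar>y\<bar> < r \<Longrightarrow> ((\<lambda>(i, j). c i j * x ^ i * y ^ j) has_sum R x y) UNIV"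
    using order_geE[OF assms(1)] by blast
  define d where "d l m = (\<Sum>i\<in>{l..l+m}. c i (l+m-i) * of_nat (i choose l) * \<alpha> ^ l * \<beta> ^ (i - l))"
    for l m
  define s where "s = r / (\<bar>\<alpha>\<bar> + \<bar>\<beta>\<bar> + 1)"
  have "s > 0" using c(2) by (simp add: s_def add_nonneg_pos)
  have "((\<lambda>(l, m). d l m * x ^ l * y ^ m) has_sum R (\<alpha> * x + \<beta> * y) y) UNIV"
    if xy: "\<bar>x\<bar> < s" "\<bar>y\<bar> < s" for x y
  proof -
    have "\<bar>\<alpha>\<bar> * \<bar>x\<bar> + \<bar>\<beta>\<bar> * \<bar>y\<bar> + \<bar>y\<bar> \<le> \<bar>\<alpha>\<bar> * s + \<bar>\<beta>\<bar> * s + \<bar>y\<bar>"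
      using xy by (intro add_mono mult_left_mono) auto
    also have "\<dots> < \<bar>\<alpha>\<bar> * s + \<bar>\<beta>\<bar> * s + s" using xy by simp
    also have "\<dots> = s * (\<bar>\<alpha>\<bar> + \<bar>\<beta>\<bar> + 1)" by (simp add: algebra_simps)
    also have "\<dots> = r" using add_nonneg_pos[of "\<bar>\<alpha>\<bar> + \<bar>\<beta>\<bar>" 1] by (simp add: s_def)
    finally have small: "\<bar>\<alpha>\<bar> * \<bar>x\<bar> + \<bar>\<beta>\<bar> * \<bar>y\<bar> + \<bar>y\<bar> < r" .
    define z where "z = \<bar>\<alpha> * x\<bar> + \<bar>\<beta> * y\<bar>"
    have z: "\<bar>z\<bar> < r" "\<bar>y\<bar> < r" "\<bar>\<alpha> * x + \<beta> * y\<bar> < r" "z \<ge> 0"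
      using small abs_triangle_ineq[of "\<alpha> * x" "\<beta> * y"] by (auto simp: z_def abs_mult)
        (smt (verit) abs_mult zero_le_mult_iff abs_ge_zero)+
    define f where "f = (\<lambda>((i, j), l). c i j * (of_nat (i choose l) * (\<alpha> * x) ^ l * (\<beta> * y) ^ (i - l)) * y ^ j)"
    let ?T = "Sigma UNIV (\<lambda>(i, j). {..i}) :: ((nat \<times> nat) \<times> nat) set"
    have fibre: "((\<lambda>l. f (p, l)) has_sum (case p of (i, j) \<Rightarrow> c i j * (\<alpha> * x + \<beta> * y) ^ i * y ^ j))
        (case p of (i, j) \<Rightarrow> {..i})" for p
      by (cases p) (simp add: f_def binomial_ring sum_distrib_left sum_distrib_right)
    have fibre_abs: "((\<lambda>l. \<bar>f (p, l)\<bar>) has_sum \<bar>case p of (i, j) \<Rightarrow> c i j * z ^ i * y ^ j\<bar>)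
        (case p of (i, j) \<Rightarrow> {..i})" for p
    proof (cases p)
      case (Pair i j)
      have "z ^ i = (\<Sum>l\<le>i. of_nat (i choose l) * \<bar>\<alpha> * x\<bar> ^ l * \<bar>\<beta> * y\<bar> ^ (i - l))"
        by (simp add: z_def binomial_ring)
      moreover have "\<bar>c i j * z ^ i * y ^ j\<bar> = \<bar>c i j\<bar> * z ^ i * \<bar>y\<bar> ^ j"
        using z(4) by (simp add: abs_mult power_abs)
      ultimately show ?thesis
        by (simp add: Pair f_def abs_mult power_abs power_mult_distrib sum_distrib_left sum_distrib_right)
    qed
    have "(\<lambda>p. \<bar>case p of (i, j) \<Rightarrow> c i j * z ^ i * y ^ j\<bar>) summable_on UNIV"
      using has_sum_imp_summable[OF c(3)[OF z(1,2)], THEN iffD1[OF summable_on_iff_abs_summable_on_real]]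
      by simp
    then have "(\<lambda>q. \<bar>f q\<bar>) summable_on ?T"
      by (intro summable_on_SigmaI[OF fibre_abs]) auto
    then have "f summable_on ?T"
      using summable_on_iff_abs_summable_on_real[of f ?T] by simp
    then have sum_f: "(f has_sum R (\<alpha> * x + \<beta> * y) y) ?T"
      using c(3)[OF z(3,2)] by (intro has_sum_SigmaI[OF fibre]) auto
    \<comment> \<open>Collect the triples by the exponents of the resulting monomial.\<close>
    define h where "h = (\<lambda>((l, m), i). f ((i, l + m - i), l))"
    have "(f has_sum R (\<alpha> * x + \<beta> * y) y) ?T \<longleftrightarrow>
      (h has_sum R (\<alpha> * x + \<beta> * y) y) (Sigma UNIV (\<lambda>(l, m). {l..l+m}))"
      by (rule has_sum_reindex_bij_witness[where i = "\<lambda>((l, m), i). ((i, l + m - i), l)"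
            and j = "\<lambda>((i, j), l). ((l, i - l + j), i)"]) (auto simp: h_def)
    moreover have "((\<lambda>i. h (p, i)) has_sum (case p of (l, m) \<Rightarrow> d l m * x ^ l * y ^ m))
        (case p of (l, m) \<Rightarrow> {l..l+m})" for p
    proof (cases p)
      case (Pair l m)
      have "h ((l, m), i) =
          c i (l+m-i) * of_nat (i choose l) * \<alpha> ^ l * \<beta> ^ (i - l) * x ^ l * y ^ m"
        if "i \<in> {l..l+m}" for i
      proof -
        have "y ^ m = y ^ (i - l) * y ^ (l + m - i)"
          using that by (simp flip: power_add)
        then show ?thesis by (simp add: h_def f_def power_mult_distrib)
      qed
      then show ?thesis
        by (simp add: Pair d_def sum_distrib_right has_sum_finite_iff)
    qed
    ultimately show ?thesis
      using sum_f by (blast intro: has_sum_SigmaD)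
  qed
  moreover have "d l m = 0" if "l + m < k" for l m
    using that c(1) by (simp add: d_def)
  ultimately show ?thesis
    unfolding order_ge_def using \<open>s > 0\<close>
    by (intro CollectI exI[of _ d] conjI exI[of _ s]) auto
qed

lemma order_ge_subst_second:
  assumes "R \<in> order_ge k"
  shows "(\<lambda>x y. R x (\<gamma> * x + \<delta> * y)) \<in> order_ge k"
  using order_ge_swap[OF order_ge_subst_first[OF order_ge_swap[OF assms], of \<delta> \<gamma>]]
  by (simp add: add.commute)

text \<open>
  Every linear substitution is a composition of substitutions that change a single variable and
  exchanges of the two variables. For \<open>d \<noteq> 0\<close>, replace \<open>x\<close> by \<open>(a - bc/d)x + (b/d)y\<close> and then \<open>y\<close>
  by \<open>cx + dy\<close>.
\<close>

lemma order_ge_linear_subst: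
  assumes R: "R \<in> order_ge k"
  shows "(\<lambda>x y. R (a * x + b * y) (c * x + d * y)) \<in> order_ge k"
proof -
  have *: "(\<lambda>x y. R (a * x + b * y) (c * x + d * y)) \<in> order_ge k" if "d \<noteq> 0" for a b c d
  proof -
    have "(\<lambda>x y. R ((a - b * c / d) * x + b / d * (c * x + d * y)) (c * x + d * y)) \<in> order_ge k"
      by (rule order_ge_subst_second[OF order_ge_subst_first[OF R]])
    moreover have "(a - b * c / d) * x + b / d * (c * x + d * y) = a * x + b * y" for x y
      using that by (simp add: field_simps)
    ultimately show ?thesis by simp
  qed
  consider "d \<noteq> 0" | "d = 0" "c \<noteq> 0" | "d = 0" "c = 0" by blast
  then show ?thesis
  proof cases
    case 1
    then show ?thesis by (rule *)
  next
    case 2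
    then show ?thesis using order_ge_swap[OF *[of c b a d]] by (simp add: add.commute)
  next
    case 3
    have "(\<lambda>x y. R x (0 * x + 0 * y)) \<in> order_ge k"
      by (rule order_ge_subst_second[OF R])
    from order_ge_subst_first[OF this, of a b] show ?thesis using 3 by simp
  qed
qed

text \<open>
  If \<open>\<bar>x\<bar> + \<bar>y\<bar> = \<tau>\<rho>\<close> with \<open>\<tau> \<le> 1\<close>, a term of degree \<open>n \<ge> k\<close> is at most
  \<open>\<tau>\<^sup>n \<le> \<tau>\<^sup>k\<close> times its size at \<open>(\<rho>, \<rho>)\<close>, where the series converges absolutely.
\<close>

lemma order_ge_bound:
  assumes "R \<in> order_ge k"
  obtains \<rho> C where "\<rho> > 0"
    "\<And>x y. \<bar>x\<bar> + \<bar>y\<bar> \<le> \<rho> \<Longrightarrow> \<bar>R x y\<bar> \<le> C * (\<bar>x\<bar> + \<bar>y\<bar>) ^ k"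
proof -
  obtain c r where c: "\<And>i j. i + j < k \<Longrightarrow> c i j = 0" "r > 0"
    "\<And>x y. \<bar>x\<bar> < r \<Longrightarrow> \<bar>y\<bar> < r \<Longrightarrow> ((\<lambda>(i, j). c i j * x ^ i * y ^ j) has_sum R x y) UNIV"
    using order_geE[OF assms(1)] by blast
  define \<rho> where "\<rho> = r / 2"
  have \<rho>: "\<rho> > 0" "\<rho> < r" using c(2) by (auto simp: \<rho>_def)
  define g where "g = (\<lambda>(i, j). \<bar>c i j\<bar> * \<rho> ^ (i + j))"
  have "(\<lambda>(i, j). c i j * \<rho> ^ i * \<rho> ^ j) summable_on UNIV"
    using \<rho> by (intro has_sum_imp_summable[OF c(3)]) auto
  then have "(\<lambda>p. norm (case p of (i, j) \<Rightarrow> c i j * \<rho> ^ i * \<rho> ^ j)) summable_on UNIV"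
    by (rule iffD1[OF summable_on_iff_abs_summable_on_real])
  moreover have "(\<lambda>p. norm (case p of (i, j) \<Rightarrow> c i j * \<rho> ^ i * \<rho> ^ j)) = g"
    using \<rho> by (auto simp: g_def abs_mult power_add fun_eq_iff)
  ultimately have g: "(g has_sum infsum g UNIV) UNIV" by simp
  have "\<bar>R x y\<bar> \<le> (infsum g UNIV / \<rho> ^ k) * (\<bar>x\<bar> + \<bar>y\<bar>) ^ k"
    if xy: "\<bar>x\<bar> + \<bar>y\<bar> \<le> \<rho>" for x y
  proof -
    define \<tau> where "\<tau> = (\<bar>x\<bar> + \<bar>y\<bar>) / \<rho>"
    have \<tau>: "0 \<le> \<tau>" "\<tau> \<le> 1" using xy \<rho> by (auto simp: \<tau>_def)
    have "norm (case p of (i, j) \<Rightarrow> c i j * x ^ i * y ^ j) \<le> \<tau> ^ k * g p" for p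
    proof (cases p)
      case (Pair i j)
      show ?thesis
      proof (cases "i + j < k")
        case True
        then show ?thesis using c(1) by (simp add: Pair g_def)
      next
        case False
        have "\<bar>x\<bar> ^ i * \<bar>y\<bar> ^ j \<le> (\<tau> * \<rho>) ^ i * (\<tau> * \<rho>) ^ j"
          using \<rho> by (intro mult_mono power_mono) (auto simp: \<tau>_def)
        also have "\<dots> = \<tau> ^ (i + j) * \<rho> ^ (i + j)"
          by (simp add: power_add power_mult_distrib mult_ac)
        also have "\<dots> \<le> \<tau> ^ k * \<rho> ^ (i + j)"
          using False \<tau> \<rho> by (intro mult_right_mono power_decreasing) auto
        finally have "\<bar>c i j\<bar> * (\<bar>x\<bar> ^ i * \<bar>y\<bar> ^ j) \<le> \<bar>c i j\<bar> * (\<tau> ^ k * \<rho> ^ (i + j))"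
          by (intro mult_left_mono) auto
        then show ?thesis by (simp add: Pair g_def abs_mult power_abs mult_ac)
      qed
    qed
    moreover have "((\<lambda>(i, j). c i j * x ^ i * y ^ j) has_sum R x y) UNIV"
      using xy \<rho> by (intro c(3)) auto
    ultimately have "norm (R x y) \<le> \<tau> ^ k * infsum g UNIV"
      by (intro norm_infsum_le[OF _ has_sum_cmult_right[OF g]]) auto
    then show ?thesis by (simp add: \<tau>_def power_divide mult.commute)
  qed
  then show thesis using that \<rho>(1) by blast
qed

section \<open>Binary quadratic forms\<close>

lemma quad_form_lin_comb:
  "m * quad_form a b c x y + n * quad_form a' b' c' x y
     = quad_form (m * a + n * a') (m * b + n * b') (m * c + n * c') x y"
  by (simp add: quad_form_def algebra_simps)

lemma quad_form_swap: "quad_form a b c x y = quad_form c b a y x"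
  by (simp add: quad_form_def)

fun form_discriminant :: "form \<Rightarrow> real" where
  "form_discriminant Form2a = 0"
| "form_discriminant Form2b = 0"
| "form_discriminant Form2c = 1"
| "form_discriminant Form2d = - 4"

lemma form_u_quad_form:
  obtains a b c where "form_u k = quad_form a b c" "b\<^sup>2 - 4 * a * c = form_discriminant k"
proof (cases k)
  case Form2a
  then show thesis by (intro that[of 0 0 0]) (auto simp: fun_eq_iff quad_form_def)
next
  case Form2b
  then show thesis by (intro that[of 1 0 0]) (auto simp: fun_eq_iff quad_form_def)
next
  case Form2c
  then show thesis by (intro that[of 0 1 0]) (auto simp: fun_eq_iff quad_form_def)
next
  case Form2d
  then show thesis by (intro that[of 1 0 1]) (auto simp: fun_eq_iff quad_form_def)
qed

text \<open>
  Completing the square turns a multiple of the form into \<open>x\<^sup>2 + \<delta>y\<^sup>2\<close>, and the sign of \<open>\<delta>\<close>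
  decides between the three nonzero normal forms; for \<open>\<delta> = - s\<^sup>2\<close> the new coordinates are the two
  linear factors \<open>x - sy\<close> and \<open>x + sy\<close>.
\<close>

lemma quad_form_normal_form_square:
  assumes "p \<noteq> 0"
  obtains k \<kappa> a b c d where "\<kappa> \<noteq> 0" "a * d - b * c \<noteq> 0"
    "\<And>x y. \<kappa> * quad_form p q r (a * x + b * y) (c * x + d * y) = form_u k x y"
proof -
  define m where "m = q / (2 * p)"
  define \<delta> where "\<delta> = r / p - m\<^sup>2"
  have sq: "1 / p * quad_form p q r x y = (x + m * y)\<^sup>2 + \<delta> * y\<^sup>2" for x y
    using assms by (simp add: quad_form_def m_def \<delta>_def field_simps power2_eq_square)
  consider "\<delta> = 0" | "\<delta> > 0" | "\<delta> < 0" by linarith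
  then show thesis
  proof cases
    case 1
    show thesis
      by (rule that[of "1 / p" 1 1 "- m" 0 Form2b]) (use 1 assms in \<open>auto simp: sq simp del: times_divide_eq_left\<close>)
  next
    case 2
    define s where "s = sqrt \<delta>"
    have s: "s > 0" "\<delta> = s\<^sup>2" using 2 by (auto simp: s_def)
    show thesis
      by (rule that[of "1 / p" 1 "1 / s" "- m / s" 0 Form2d])
        (use s assms in \<open>auto simp: sq field_simps power2_eq_square simp del: times_divide_eq_left\<close>)
  next
    case 3
    define s where "s = sqrt (- \<delta>)"
    have s: "s > 0" "\<delta> = - s\<^sup>2" using 3 by (auto simp: s_def)
    define a b c d where "a = 1 / 2 + m / (2 * s)" and "b = 1 / 2 - m / (2 * s)"
      and "c = - 1 / (2 * s)" and "d = 1 / (2 * s)"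
    have "1 / p * quad_form p q r (a * x + b * y) (c * x + d * y) = x * y" for x y
    proof -
      have 1: "a * x + b * y + m * (c * x + d * y) = (x + y) / 2"
        using s by (simp add: a_def b_def c_def d_def field_simps)
      have 2: "s * (c * x + d * y) = (y - x) / 2"
        using s by (simp add: c_def d_def field_simps)
      have "\<delta> * (c * x + d * y)\<^sup>2 = - (s * (c * x + d * y))\<^sup>2"
        by (simp add: s(2) power_mult_distrib)
      then show ?thesis unfolding sq 1 2
        by (simp add: power2_eq_square field_simps)
    qed
    moreover have "a * d - b * c \<noteq> 0"
      using s by (simp add: a_def b_def c_def d_def field_simps)
    ultimately show thesis
      using assms by (intro that[of "1 / p" a d b c Form2c]) auto
  qed
qed

lemma quad_form_normal_form:
  obtains k \<kappa> a b c d where "\<kappa> \<noteq> 0" "a * d - b * c \<noteq> 0"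
    "\<And>x y. \<kappa> * quad_form p q r (a * x + b * y) (c * x + d * y) = form_u k x y"
proof -
  consider "p \<noteq> 0" | "r \<noteq> 0" | "p = 0" "r = 0" "q \<noteq> 0" | "p = 0" "q = 0" "r = 0" by blast
  then show thesis
  proof cases
    case 1
    then show thesis using that by (rule quad_form_normal_form_square)
  next
    case 2
    then obtain k \<kappa> a b c d where *: "\<kappa> \<noteq> 0" "a * d - b * c \<noteq> 0"
      "\<And>x y. \<kappa> * quad_form r q p (a * x + b * y) (c * x + d * y) = form_u k x y"
      using that by (rule quad_form_normal_form_square)
    then show thesis
      by (intro that[of \<kappa> c b d a k]) (auto simp: quad_form_swap[of p q r] mult.commute)
  next
    case 3
    show thesis
      by (rule that[of "1 / q" 1 1 0 0 Form2c]) (use 3 in \<open>auto simp: quad_form_def\<close>)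
  next
    case 4
    show thesis
      by (rule that[of 1 1 1 0 0 Form2a]) (use 4 in \<open>auto simp: quad_form_def\<close>)
  qed
qed

lemma quad_form_eq_coeffs:
  assumes "\<And>x y. \<kappa> * quad_form a b c x y = quad_form a' b' c' (p * x + q * y) (r * x + s * y)"
  shows "\<kappa> * a = a' * p\<^sup>2 + b' * p * r + c' * r\<^sup>2"
    and "\<kappa> * b = 2 * a' * p * q + b' * (p * s + q * r) + 2 * c' * r * s"
    and "\<kappa> * c = a' * q\<^sup>2 + b' * q * s + c' * s\<^sup>2"
proof -
  show 1: "\<kappa> * a = a' * p\<^sup>2 + b' * p * r + c' * r\<^sup>2"
    using assms[of 1 0] by (simp add: quad_form_def)
  show 3: "\<kappa> * c = a' * q\<^sup>2 + b' * q * s + c' * s\<^sup>2"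
    using assms[of 0 1] by (simp add: quad_form_def)
  show "\<kappa> * b = 2 * a' * p * q + b' * (p * s + q * r) + 2 * c' * r * s"
    using assms[of 1 1] 1 3 by (simp add: quad_form_def algebra_simps power2_eq_square)
qed

lemma discriminant_quad_form:
  assumes "\<And>x y. \<kappa> * quad_form a b c x y = quad_form a' b' c' (p * x + q * y) (r * x + s * y)"
  shows "\<kappa>\<^sup>2 * (b\<^sup>2 - 4 * a * c) = (p * s - q * r)\<^sup>2 * (b'\<^sup>2 - 4 * a' * c')"
proof -
  have "\<kappa>\<^sup>2 * (b\<^sup>2 - 4 * a * c) = (\<kappa> * b)\<^sup>2 - 4 * (\<kappa> * a) * (\<kappa> * c)"
    by (simp add: algebra_simps power2_eq_square)
  also have "\<dots> = (p * s - q * r)\<^sup>2 * (b'\<^sup>2 - 4 * a' * c')"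
    unfolding quad_form_eq_coeffs[OF assms] by (simp add: algebra_simps power2_eq_square)
  finally show ?thesis .
qed

text \<open>
  The sign of the discriminant is invariant and equals \<open>0, 0, 1, -1\<close> on the four normal forms;
  the first two differ in whether the form vanishes.
\<close>

lemma normal_forms_inequivalent:
  assumes eq: "\<And>x y. \<kappa> * form_u k x y = form_u l (p * x + q * y) (r * x + s * y)"
    and "\<kappa> \<noteq> 0" and det: "p * s - q * r \<noteq> 0"
  shows "k = l"
proof -
  have pos: "\<kappa>\<^sup>2 > 0" "(p * s - q * r)\<^sup>2 > 0" using assms(2) det by auto
  obtain a b c where abc: "form_u k = quad_form a b c" "b\<^sup>2 - 4 * a * c = form_discriminant k"
    by (rule form_u_quad_form)
  obtain a' b' c' where abc': "form_u l = quad_form a' b' c'"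
    "b'\<^sup>2 - 4 * a' * c' = form_discriminant l"
    by (rule form_u_quad_form)
  have disc: "\<kappa>\<^sup>2 * form_discriminant k = (p * s - q * r)\<^sup>2 * form_discriminant l"
    unfolding abc(2)[symmetric] abc'(2)[symmetric]
    by (rule discriminant_quad_form) (use eq in \<open>simp add: abc(1) abc'(1)\<close>)
  have "k = l" if kl: "k = Form2a" "l = Form2b"
  proof -
    have "p = 0" "q = 0" using eq[of 1 0] eq[of 0 1] by (auto simp: kl)
    then show ?thesis using det by simp
  qed
  moreover have "k = l" if kl: "k = Form2b" "l = Form2a"
    using eq[of 1 0] assms(2) by (simp add: kl)
  ultimately show ?thesis
    using disc pos by (cases k; cases l) auto
qed

section \<open>Block-diagonal changes of coordinates\<close>

lemma vector_4:
  "(vector [a, b, c, d] :: 'a::zero^4) $ 1 = a" "(vector [a, b, c, d] :: 'a^4) $ 2 = b"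
  "(vector [a, b, c, d] :: 'a^4) $ 3 = c" "(vector [a, b, c, d] :: 'a^4) $ 4 = d"
  unfolding vector_def by simp_all

lemma matrix_vector_mult_4:
  fixes A :: "real^4^4"
  shows "(A *v p) $ i = A$i$1 * p$1 + A$i$2 * p$2 + A$i$3 * p$3 + A$i$4 * p$4"
  by (simp add: matrix_vector_mult_def sum_4)

text \<open>
  The coefficients \<open>a, b, c, d\<close> express the old \<open>x\<close>, \<open>y\<close> in terms of the new ones, because this
  is the substitution that appears in the new graph; so the upper block of the matrix is the
  inverse of theirs. The lower block takes the combinations of \<open>u\<close>, \<open>v\<close> as they stand.
\<close>

lemma block_change_of_coordinates:
  fixes a b c d m n m' n' :: real
  assumes det: "a * d - b * c \<noteq> 0" and det': "m * n' - n * m' \<noteq> 0"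
  obtains A :: "real^4^4" where "invertible A"
    "\<And>F G. (\<lambda>p. A *v p) ` surface F G =
       surface (\<lambda>x y. m * F (a * x + b * y) (c * x + d * y) + n * G (a * x + b * y) (c * x + d * y))
               (\<lambda>x y. m' * F (a * x + b * y) (c * x + d * y) + n' * G (a * x + b * y) (c * x + d * y))"
proof -
  define D where "D = a * d - b * c"
  define E where "E = m * n' - n * m'"
  have DE: "D \<noteq> 0" "E \<noteq> 0" using assms by (auto simp: D_def E_def)
  define A :: "real^4^4" where "A = vector [vector [d / D, - b / D, 0, 0], vector [- c / D, a / D, 0, 0],
     vector [0, 0, m, n], vector [0, 0, m', n']]"
  define B :: "real^4^4" where "B = vector [vector [a, b, 0, 0], vector [c, d, 0, 0],
     vector [0, 0, n' / E, - n / E], vector [0, 0, - m' / E, m / E]]"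
  have AB: "A *v (B *v p) = p" and BA: "B *v (A *v p) = p" for p
    using DE by (auto simp: vec_eq_iff forall_4 matrix_vector_mult_4 A_def B_def vector_4 field_simps)
      (auto simp: D_def E_def algebra_simps)
  have "A ** B = mat 1" "B ** A = mat 1"
    by (auto simp: matrix_eq AB BA simp flip: matrix_vector_mul_assoc)
  then have "invertible A" unfolding invertible_def by blast
  moreover have "(\<lambda>p. A *v p) ` surface F G =
       surface (\<lambda>x y. m * F (a * x + b * y) (c * x + d * y) + n * G (a * x + b * y) (c * x + d * y))
               (\<lambda>x y. m' * F (a * x + b * y) (c * x + d * y) + n' * G (a * x + b * y) (c * x + d * y))"
    (is "_ = ?S") for F G
  proof -
    have mem: "A *v p \<in> ?S" if "p \<in> surface F G" for p
    proof -
      have "a * (A *v p)$1 + b * (A *v p)$2 = (B *v (A *v p))$1"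
        "c * (A *v p)$1 + d * (A *v p)$2 = (B *v (A *v p))$2"
        unfolding matrix_vector_mult_4[of B] by (simp_all add: B_def vector_4)
      moreover have "(A *v p)$3 = m * p$3 + n * p$4" "(A *v p)$4 = m' * p$3 + n' * p$4"
        by (simp_all add: matrix_vector_mult_4 A_def vector_4)
      ultimately show ?thesis using that by (simp add: BA surface_def)
    qed
    have mem': "B *v p \<in> surface F G" if "p \<in> ?S" for p
      using that DE by (auto simp: surface_def matrix_vector_mult_4 B_def vector_4 field_simps)
        (auto simp: E_def algebra_simps)
    show ?thesis
      using mem mem' AB by (metis (no_types, lifting) image_iff subsetI subset_antisym image_subsetI)
  qed
  ultimately show thesis by (rule that)
qed

section \<open>Reduction to a normal form\<close>

text \<open>
  If \<open>\<alpha>F\<^sub>2 + \<beta>G\<^sub>2 = 0\<close>, then \<open>v' = \<alpha>u + \<beta>v\<close> has order 3 along the surface, and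
  \<open>u' = \<kappa>(\<beta>u - \<alpha>v)\<close> completes it to coordinates, since the determinant is
  \<open>\<kappa>(\<alpha>\<^sup>2 + \<beta>\<^sup>2)\<close>. What remains is to normalise the quadratic part of \<open>u'\<close> by a linear
  change of \<open>x\<close>, \<open>y\<close> and the choice of \<open>\<kappa>\<close>.
\<close>

lemma parallel_surface_has_normal_form:
  assumes F: "(\<lambda>x y. F x y - quad_form F20 F11 F02 x y) \<in> order_ge 3"
    and G: "(\<lambda>x y. G x y - quad_form G20 G11 G02 x y) \<in> order_ge 3"
    and dep: "lin_dependent_pair (quad_form F20 F11 F02) (quad_form G20 G11 G02)"
  obtains k F' G' and A :: "real^4^4" where "has_form k F' G'" "invertible A"
    "maps_germ (\<lambda>p. A *v p) (surface F G) (surface F' G')"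
proof -
  obtain \<alpha> \<beta> where nz: "\<alpha> \<noteq> 0 \<or> \<beta> \<noteq> 0"
    and zero: "\<And>x y. \<alpha> * quad_form F20 F11 F02 x y + \<beta> * quad_form G20 G11 G02 x y = 0"
    using dep unfolding lin_dependent_pair_def by auto
  obtain k \<kappa> a b c d where nf: "\<kappa> \<noteq> 0" "a * d - b * c \<noteq> 0"
    "\<And>x y. \<kappa> * quad_form (\<beta> * F20 + - \<alpha> * G20) (\<beta> * F11 + - \<alpha> * G11) (\<beta> * F02 + - \<alpha> * G02)
        (a * x + b * y) (c * x + d * y) = form_u k x y"
    using that by (rule quad_form_normal_form)
  have "\<kappa> * \<beta> * \<beta> - - \<kappa> * \<alpha> * \<alpha> = \<kappa> * (\<alpha>\<^sup>2 + \<beta>\<^sup>2)"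
    by (simp add: power2_eq_square algebra_simps)
  also have "\<dots> \<noteq> 0" using nf(1) nz by (simp add: sum_power2_eq_zero_iff)
  finally obtain A :: "real^4^4" where A: "invertible A"
    "\<And>F G. (\<lambda>p. A *v p) ` surface F G =
       surface (\<lambda>x y. \<kappa> * \<beta> * F (a * x + b * y) (c * x + d * y) + - \<kappa> * \<alpha> * G (a * x + b * y) (c * x + d * y))
               (\<lambda>x y. \<alpha> * F (a * x + b * y) (c * x + d * y) + \<beta> * G (a * x + b * y) (c * x + d * y))"
    using block_change_of_coordinates[OF nf(2)] by blast
  let ?F' = "\<lambda>x y. \<kappa> * \<beta> * F (a * x + b * y) (c * x + d * y) + - \<kappa> * \<alpha> * G (a * x + b * y) (c * x + d * y)"
  let ?G' = "\<lambda>x y. \<alpha> * F (a * x + b * y) (c * x + d * y) + \<beta> * G (a * x + b * y) (c * x + d * y)"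
  have comb: "(\<lambda>x y. m * (F (a * x + b * y) (c * x + d * y) - quad_form F20 F11 F02 (a * x + b * y) (c * x + d * y))
      + n * (G (a * x + b * y) (c * x + d * y) - quad_form G20 G11 G02 (a * x + b * y) (c * x + d * y)))
      \<in> order_ge 3" for m n
    by (intro order_ge_add order_ge_scale order_ge_linear_subst[OF F] order_ge_linear_subst[OF G])
  have "?F' x y - form_u k x y =
      \<kappa> * \<beta> * (F (a * x + b * y) (c * x + d * y) - quad_form F20 F11 F02 (a * x + b * y) (c * x + d * y))
      + - \<kappa> * \<alpha> * (G (a * x + b * y) (c * x + d * y) - quad_form G20 G11 G02 (a * x + b * y) (c * x + d * y))" for x y
    unfolding nf(3)[symmetric] quad_form_lin_comb[symmetric] by (simp add: algebra_simps)
  moreover have "?G' x y =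
      \<alpha> * (F (a * x + b * y) (c * x + d * y) - quad_form F20 F11 F02 (a * x + b * y) (c * x + d * y))
      + \<beta> * (G (a * x + b * y) (c * x + d * y) - quad_form G20 G11 G02 (a * x + b * y) (c * x + d * y))" for x y
    using zero[of "a * x + b * y" "c * x + d * y"] by (simp add: algebra_simps)
  ultimately have "has_form k ?F' ?G'"
    unfolding has_form_def using comb by presburger
  moreover have "maps_germ (\<lambda>p. A *v p) (surface F G) (surface ?F' ?G')"
    by (simp add: maps_germ_def same_germ_def A(2))
  ultimately show thesis using A(1) that by blast
qed

section \<open>Second-order comparison along a linear map\<close>

text \<open>
  Along arguments of size \<open>O(t)\<close> the remainder is \<open>O(t\<^sup>3)\<close>, hence invisible after division by
  \<open>t\<^sup>2\<close>; the quadratic part is homogeneous and only sees the limiting direction \<open>(X, Y)\<close>. The curve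
  \<open>(\<xi>, \<eta>)\<close> is general because it has to be the projection of the image of a curve under a linear
  map, which need not be a straight line.
\<close>

lemma second_order_limit:
  assumes F: "(\<lambda>x y. F x y - quad_form a b c x y) \<in> order_ge 3"
    and \<xi>: "((\<lambda>t. \<xi> t / t) \<longlongrightarrow> X) (at_right 0)" and \<eta>: "((\<lambda>t. \<eta> t / t) \<longlongrightarrow> Y) (at_right 0)"
  shows "((\<lambda>t. F (\<xi> t) (\<eta> t) / t\<^sup>2) \<longlongrightarrow> quad_form a b c X Y) (at_right 0)"
proof -
  obtain \<rho> C where \<rho>: "\<rho> > 0" and C: "\<And>x y. \<bar>x\<bar> + \<bar>y\<bar> \<le> \<rho> \<Longrightarrow>
      \<bar>F x y - quad_form a b c x y\<bar> \<le> C * (\<bar>x\<bar> + \<bar>y\<bar>) ^ 3"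
    using that by (rule order_ge_bound[OF F])
  have pos: "\<forall>\<^sub>F t in at_right 0. (t :: real) > 0"
    by (simp add: eventually_at_right_less)
  have id: "((\<lambda>t. t) \<longlongrightarrow> (0 :: real)) (at_right 0)" by simp
  let ?n = "\<lambda>t. \<bar>\<xi> t / t\<bar> + \<bar>\<eta> t / t\<bar>"
  have n: "(?n \<longlongrightarrow> \<bar>X\<bar> + \<bar>Y\<bar>) (at_right 0)"
    by (intro tendsto_intros \<xi> \<eta>)
  have "((\<lambda>t. ?n t * t) \<longlongrightarrow> (\<bar>X\<bar> + \<bar>Y\<bar>) * 0) (at_right 0)"
    by (intro tendsto_mult n id)
  then have small: "\<forall>\<^sub>F t in at_right 0. ?n t * t < \<rho>"
    by (rule order_tendstoD(2)) (use \<rho> in simp)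
  have lim: "((\<lambda>t. C * ?n t ^ 3 * t) \<longlongrightarrow> C * (\<bar>X\<bar> + \<bar>Y\<bar>) ^ 3 * 0) (at_right 0)"
    by (intro tendsto_intros n id)
  have "((\<lambda>t. (F (\<xi> t) (\<eta> t) - quad_form a b c (\<xi> t) (\<eta> t)) / t\<^sup>2) \<longlongrightarrow> 0) (at_right 0)"
  proof (rule Lim_null_comparison)
    show "((\<lambda>t. C * ?n t ^ 3 * t) \<longlongrightarrow> 0) (at_right 0)" using lim by simp
    show "\<forall>\<^sub>F t in at_right 0. norm ((F (\<xi> t) (\<eta> t) - quad_form a b c (\<xi> t) (\<eta> t)) / t\<^sup>2)
        \<le> C * ?n t ^ 3 * t"
      using pos small
    proof eventually_elim
      case (elim t)
      have n: "?n t * t = \<bar>\<xi> t\<bar> + \<bar>\<eta> t\<bar>" 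
        using elim by (simp add: distrib_right)
      have le: "\<bar>\<xi> t\<bar> + \<bar>\<eta> t\<bar> \<le> \<rho>" using elim(2) unfolding n by (rule less_imp_le)
      have "\<bar>F (\<xi> t) (\<eta> t) - quad_form a b c (\<xi> t) (\<eta> t)\<bar> \<le> C * (?n t * t) ^ 3"
        unfolding n by (rule C[OF le])
      also have "\<dots> = C * ?n t ^ 3 * t * t\<^sup>2"
        by (simp only: power_mult_distrib power2_eq_square power3_eq_cube mult_ac)
      finally have "\<bar>F (\<xi> t) (\<eta> t) - quad_form a b c (\<xi> t) (\<eta> t)\<bar> / t\<^sup>2 \<le> C * ?n t ^ 3 * t"
        using elim(1) by (subst pos_divide_le_eq) (simp_all only: zero_less_power)
      then show ?case by (simp only: real_norm_def abs_divide abs_power2)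
    qed
  qed
  moreover have "((\<lambda>t. quad_form a b c (\<xi> t / t) (\<eta> t / t)) \<longlongrightarrow> quad_form a b c X Y) (at_right 0)"
    unfolding quad_form_def by (intro tendsto_intros \<xi> \<eta>)
  ultimately have "((\<lambda>t. (F (\<xi> t) (\<eta> t) - quad_form a b c (\<xi> t) (\<eta> t)) / t\<^sup>2
      + quad_form a b c (\<xi> t / t) (\<eta> t / t)) \<longlongrightarrow> 0 + quad_form a b c X Y) (at_right 0)"
    by (rule tendsto_add)
  then have "((\<lambda>t. (F (\<xi> t) (\<eta> t) - quad_form a b c (\<xi> t) (\<eta> t)) / t\<^sup>2
      + quad_form a b c (\<xi> t / t) (\<eta> t / t)) \<longlongrightarrow> quad_form a b c X Y) (at_right 0)"
    by simp
  moreover have "\<forall>\<^sub>F t in at_right 0. (F (\<xi> t) (\<eta> t) - quad_form a b c (\<xi> t) (\<eta> t)) / t\<^sup>2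
      + quad_form a b c (\<xi> t / t) (\<eta> t / t) = F (\<xi> t) (\<eta> t) / t\<^sup>2"
    using pos
  proof eventually_elim
    case (elim t)
    then have "quad_form a b c (\<xi> t / t) (\<eta> t / t) = quad_form a b c (\<xi> t) (\<eta> t) / t\<^sup>2"
      by (simp add: quad_form_def power2_eq_square field_simps)
    then show ?case by (simp add: diff_divide_distrib)
  qed
  ultimately show ?thesis by (rule Lim_transform_eventually)
qed

text \<open>
  Follow the curve \<open>t \<mapsto> (tx, ty, F(tx, ty), G(tx, ty))\<close> on the source and compare expansions at
  \<open>t = 0\<close> of the two sides of the equations of the target. At first order, \<open>(x, y)\<close>-directions must
  go to \<open>(x, y)\<close>-directions (both tangent planes are \<open>u = v = 0\<close>); at second order, the quadratic
  parts correspond.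
\<close>

lemma linear_map_between_graphs:
  fixes A :: "real^4^4"
  assumes F: "(\<lambda>x y. F x y - quad_form a b c x y) \<in> order_ge 3" and G: "G \<in> order_ge 3"
    and F': "(\<lambda>x y. F' x y - quad_form a' b' c' x y) \<in> order_ge 3" and G': "G' \<in> order_ge 3"
    and maps: "maps_germ (\<lambda>p. A *v p) (surface F G) (surface F' G')"
  shows "A$3$1 * x + A$3$2 * y = 0" "A$4$1 * x + A$4$2 * y = 0"
    "A$3$3 * quad_form a b c x y
       = quad_form a' b' c' (A$1$1 * x + A$1$2 * y) (A$2$1 * x + A$2$2 * y)"
    "A$4$3 * quad_form a b c x y = 0"
proof -
  have G0: "(\<lambda>x y. G x y - quad_form 0 0 0 x y) \<in> order_ge 3"
    and G0': "(\<lambda>x y. G' x y - quad_form 0 0 0 x y) \<in> order_ge 3"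
    using G G' by (simp_all add: quad_form_def)
  have pos: "\<forall>\<^sub>F t in at_right 0. (t :: real) > 0"
    by (simp add: eventually_at_right_less)
  have id: "((\<lambda>t. t) \<longlongrightarrow> (0 :: real)) (at_right 0)" by simp
  have lin: "((\<lambda>t. t * z / t) \<longlongrightarrow> z) (at_right 0)" for z :: real
    by (rule tendsto_eventually) (use pos in eventually_elim, simp)
  define f where "f t = F (t * x) (t * y)" for t
  define g where "g t = G (t * x) (t * y)" for t
  define P where "P t = A *v vector [t * x, t * y, f t, g t]" for t
  have P: "P t $ i = A$i$1 * (t * x) + A$i$2 * (t * y) + A$i$3 * f t + A$i$4 * g t" for t i
    by (simp add: P_def matrix_vector_mult_4 vector_4)
  have f2: "((\<lambda>t. f t / t\<^sup>2) \<longlongrightarrow> quad_form a b c x y) (at_right 0)"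
    unfolding f_def by (rule second_order_limit[OF F lin lin])
  have g2: "((\<lambda>t. g t / t\<^sup>2) \<longlongrightarrow> 0) (at_right 0)"
    using second_order_limit[OF G0 lin lin, of x y] by (simp add: g_def quad_form_def)
  have lower: "((\<lambda>t. h t / t) \<longlongrightarrow> 0) (at_right 0)"
    if "((\<lambda>t. h t / t\<^sup>2) \<longlongrightarrow> L) (at_right 0)" for h :: "real \<Rightarrow> real" and L
  proof -
    have "((\<lambda>t. h t / t\<^sup>2 * t) \<longlongrightarrow> L * 0) (at_right 0)" by (intro tendsto_mult that id)
    then have "((\<lambda>t. h t / t\<^sup>2 * t) \<longlongrightarrow> 0) (at_right 0)" by simp
    then show ?thesis
      by (rule Lim_transform_eventually)
        (use pos in eventually_elim, simp add: power2_eq_square)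
  qed
  have lin_part: "((\<lambda>t. P t $ i / t) \<longlongrightarrow> A$i$1 * x + A$i$2 * y) (at_right 0)" for i
  proof -
    have "((\<lambda>t. A$i$1 * (t * x / t) + A$i$2 * (t * y / t) + A$i$3 * (f t / t) + A$i$4 * (g t / t))
        \<longlongrightarrow> A$i$1 * x + A$i$2 * y + A$i$3 * 0 + A$i$4 * 0) (at_right 0)"
      by (intro tendsto_intros lin lower[OF f2] lower[OF g2])
    moreover have "P t $ i / t =
        A$i$1 * (t * x / t) + A$i$2 * (t * y / t) + A$i$3 * (f t / t) + A$i$4 * (g t / t)" for t
      by (simp only: P add_divide_distrib times_divide_eq_right)
    ultimately show ?thesis by simp
  qed
  \<comment> \<open>The curve tends to the origin, so near \<open>t = 0\<close> the germ hypothesis applies to it.\<close>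
  have "((\<lambda>t. P t $ i / t * t) \<longlongrightarrow> (A$i$1 * x + A$i$2 * y) * 0) (at_right 0)" for i
    by (intro tendsto_mult lin_part id)
  then have "((\<lambda>t. P t $ i / t * t) \<longlongrightarrow> 0 $ i) (at_right 0)" for i
    by simp
  then have "((\<lambda>t. P t $ i) \<longlongrightarrow> 0 $ i) (at_right 0)" for i
    by (rule Lim_transform_eventually) (use pos in eventually_elim, simp)
  then have "(P \<longlongrightarrow> 0) (at_right 0)"
    by (rule vec_tendstoI)
  moreover have "\<forall>\<^sub>F p in nhds 0. p \<in> (\<lambda>p. A *v p) ` surface F G \<longleftrightarrow> p \<in> surface F' G'"
    using maps by (simp add: maps_germ_def same_germ_def)
  ultimately have "\<forall>\<^sub>F t in at_right 0.
      P t \<in> (\<lambda>p. A *v p) ` surface F G \<longleftrightarrow> P t \<in> surface F' G'"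
    using filterlim_iff by blast
  moreover have "P t \<in> (\<lambda>p. A *v p) ` surface F G" for t
    unfolding P_def by (rule imageI) (simp add: surface_def vector_4 f_def g_def)
  ultimately have on: "\<forall>\<^sub>F t in at_right 0.
      P t $ 3 = F' (P t $ 1) (P t $ 2) \<and> P t $ 4 = G' (P t $ 1) (P t $ 2)"
    by (simp add: surface_def)
  have P3: "((\<lambda>t. P t $ 3 / t\<^sup>2) \<longlongrightarrow>
      quad_form a' b' c' (A$1$1 * x + A$1$2 * y) (A$2$1 * x + A$2$2 * y)) (at_right 0)"
    by (rule Lim_transform_eventually[OF second_order_limit[OF F' lin_part lin_part]])
      (use on in eventually_elim, simp)
  have "((\<lambda>t. P t $ 4 / t\<^sup>2) \<longlongrightarrow>
      quad_form 0 0 0 (A$1$1 * x + A$1$2 * y) (A$2$1 * x + A$2$2 * y)) (at_right 0)"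
    by (rule Lim_transform_eventually[OF second_order_limit[OF G0' lin_part lin_part]])
      (use on in eventually_elim, simp)
  then have P4: "((\<lambda>t. P t $ 4 / t\<^sup>2) \<longlongrightarrow> 0) (at_right 0)"
    by (simp add: quad_form_def)
  have nontriv: "at_right (0 :: real) \<noteq> bot" by simp
  show lin3: "A$3$1 * x + A$3$2 * y = 0"
    by (rule tendsto_unique[OF nontriv lin_part lower[OF P3]])
  show lin4: "A$4$1 * x + A$4$2 * y = 0"
    by (rule tendsto_unique[OF nontriv lin_part lower[OF P4]])
  have quad_part: "((\<lambda>t. P t $ i / t\<^sup>2) \<longlongrightarrow> A$i$3 * quad_form a b c x y) (at_right 0)"
    if "A$i$1 * x + A$i$2 * y = 0" for i
  proof -
    have "A$i$1 * (t * x) + A$i$2 * (t * y) = t * (A$i$1 * x + A$i$2 * y)" for t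
      by (simp add: algebra_simps)
    then have "P t $ i = A$i$3 * f t + A$i$4 * g t" for t
      using that by (simp add: P)
    moreover have "((\<lambda>t. A$i$3 * (f t / t\<^sup>2) + A$i$4 * (g t / t\<^sup>2)) \<longlongrightarrow>
        A$i$3 * quad_form a b c x y + A$i$4 * 0) (at_right 0)"
      by (intro tendsto_intros f2 g2)
    ultimately show ?thesis by (simp add: add_divide_distrib)
  qed
  show "A$3$3 * quad_form a b c x y
       = quad_form a' b' c' (A$1$1 * x + A$1$2 * y) (A$2$1 * x + A$2$2 * y)"
    by (rule tendsto_unique[OF nontriv quad_part[OF lin3] P3])
  show "A$4$3 * quad_form a b c x y = 0"
    by (rule tendsto_unique[OF nontriv quad_part[OF lin4] P4])
qed

text \<open>
  With a vanishing lower left block, a kernel vector of the upper left block extends by zero to one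
  of the matrix, and the last two coordinates of the image depend on the lower right block only,
  whose first column is then nonzero because they take all values.
\<close>

lemma block_triangular_invertible:
  fixes A :: "real^4^4"
  assumes inv: "invertible A" and zero: "A$3$1 = 0" "A$3$2 = 0" "A$4$1 = 0" "A$4$2 = 0"
  shows "A$1$1 * A$2$2 - A$1$2 * A$2$1 \<noteq> 0" and "A$3$3 \<noteq> 0 \<or> A$4$3 \<noteq> 0"
proof -
  obtain B where AB: "A ** B = mat 1" and BA: "B ** A = mat 1"
    using inv unfolding invertible_def by blast
  have ker: "p = 0" if "A *v p = 0" for p
    using that BA by (metis matrix_vector_mul_assoc matrix_vector_mul_lid matrix_vector_mult_0_right)
  have surj: "\<exists>p. A *v p = q" for q
    using AB by (metis matrix_vector_mul_assoc matrix_vector_mul_lid)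
  show "A$1$1 * A$2$2 - A$1$2 * A$2$1 \<noteq> 0"
  proof
    assume det: "A$1$1 * A$2$2 - A$1$2 * A$2$1 = 0"
    have plane: "x = 0 \<and> y = 0"
      if "A$1$1 * x + A$1$2 * y = 0" "A$2$1 * x + A$2$2 * y = 0" for x y
    proof -
      have "A *v vector [x, y, 0, 0] = 0"
        using that by (simp add: vec_eq_iff forall_4 matrix_vector_mult_4 vector_4 zero)
      from arg_cong[OF ker[OF this], of "\<lambda>p. (p$1, p$2)"] show ?thesis
        by (simp add: vector_4)
    qed
    \<comment> \<open>The columns of the adjugate of a singular block lie in its kernel.\<close>
    have "A$2$2 = 0 \<and> - A$2$1 = 0" "- A$1$2 = 0 \<and> A$1$1 = 0"
      by (rule plane; use det in \<open>simp add: algebra_simps\<close>)+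
    then show False using plane[of 1 0] by simp
  qed
  show "A$3$3 \<noteq> 0 \<or> A$4$3 \<noteq> 0"
  proof (rule ccontr)
    assume "\<not> ?thesis"
    then have *: "(A *v p) $ 3 = A$3$4 * p$4" "(A *v p) $ 4 = A$4$4 * p$4" for p
      by (auto simp: matrix_vector_mult_4 zero)
    obtain p q where "A *v p = vector [0, 0, 1, 0]" "A *v q = vector [0, 0, 0, 1]"
      using surj by meson
    then have "A$3$4 * p$4 = 1" "A$4$4 * p$4 = 0" "A$4$4 * q$4 = 1"
      using *[of p] *[of q] by (simp_all add: vector_4)
    then show False by auto
  qed
qed

text \<open>
  When the quadratic part of the source does not vanish, \<open>A\<^sub>4\<^sub>3 = 0\<close>, so \<open>A\<^sub>3\<^sub>3 \<noteq> 0\<close> is the factor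
  that relates the two quadratic parts; when it vanishes, so does the one of the target, and any
  factor will do.
\<close>

lemma equivalent_forms_equal:
  fixes A :: "real^4^4"
  assumes k: "has_form k F G" and l: "has_form l F' G'" and inv: "invertible A"
    and maps: "maps_germ (\<lambda>p. A *v p) (surface F G) (surface F' G')"
  shows "k = l"
proof -
  obtain a b c where abc: "form_u k = quad_form a b c" by (rule form_u_quad_form)
  obtain a' b' c' where abc': "form_u l = quad_form a' b' c'" by (rule form_u_quad_form)
  have F: "(\<lambda>x y. F x y - quad_form a b c x y) \<in> order_ge 3" and G: "G \<in> order_ge 3"
    using k unfolding has_form_def abc by auto
  have F': "(\<lambda>x y. F' x y - quad_form a' b' c' x y) \<in> order_ge 3" and G': "G' \<in> order_ge 3"
    using l unfolding has_form_def abc' by auto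
  note * = linear_map_between_graphs[OF F G F' G' maps]
  have zero: "A$3$1 = 0" "A$3$2 = 0" "A$4$1 = 0" "A$4$2 = 0"
    using *(1)[of 1 0] *(1)[of 0 1] *(2)[of 1 0] *(2)[of 0 1] by auto
  note blocks = block_triangular_invertible[OF inv zero]
  obtain \<kappa> where "\<kappa> \<noteq> 0" and \<kappa>: "\<And>x y. \<kappa> * form_u k x y
      = form_u l (A$1$1 * x + A$1$2 * y) (A$2$1 * x + A$2$2 * y)"
  proof (cases "\<forall>x y. form_u k x y = 0")
    case True
    then show thesis using *(3) by (intro that[of 1]) (auto simp: abc abc')
  next
    case False
    then have "A$4$3 = 0" using *(4) by (auto simp: abc)
    then have "A$3$3 \<noteq> 0" using blocks(2) by simp
    then show thesis using *(3) by (intro that[of "A$3$3"]) (auto simp: abc abc')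
  qed
  then show ?thesis using normal_forms_inequivalent blocks(1) by blast
qed

section \<open>The classification\<close>

theorem proposition20p1:
  "(\<forall>(F :: real \<Rightarrow> real \<Rightarrow> real) (G :: real \<Rightarrow> real \<Rightarrow> real)
      (F20 :: real) (F11 :: real) (F02 :: real) (G20 :: real) (G11 :: real) (G02 :: real).
      (\<lambda>x y. F x y - quad_form F20 F11 F02 x y) \<in> order_ge 3 \<longrightarrow>
      (\<lambda>x y. G x y - quad_form G20 G11 G02 x y) \<in> order_ge 3 \<longrightarrow>
      lin_dependent_pair (quad_form F20 F11 F02) (quad_form G20 G11 G02) \<longrightarrow>
      (\<exists>(k :: form) F' G' (A :: real^4^4).
         has_form k F' G' \<and> invertible A \<and>
         maps_germ (\<lambda>p. A *v p) (surface F G) (surface F' G'))) \<and>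
   (\<forall>(k :: form) (l :: form) F G F' G' (T :: real^4 \<Rightarrow> real^4).
      k \<noteq> l \<longrightarrow> has_form k F G \<longrightarrow> has_form l F' G' \<longrightarrow>
      affine_transformation T \<longrightarrow> T 0 = 0 \<longrightarrow>
      \<not> maps_germ T (surface F G) (surface F' G'))"
proof (rule conjI; intro allI impI)
  fix F G :: "real \<Rightarrow> real \<Rightarrow> real" and F20 F11 F02 G20 G11 G02 :: real
  assume "(\<lambda>x y. F x y - quad_form F20 F11 F02 x y) \<in> order_ge 3"
    and "(\<lambda>x y. G x y - quad_form G20 G11 G02 x y) \<in> order_ge 3"
    and "lin_dependent_pair (quad_form F20 F11 F02) (quad_form G20 G11 G02)"
  then show "\<exists>k F' G' (A :: real^4^4). has_form k F' G' \<and> invertible A \<and>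
      maps_germ (\<lambda>p. A *v p) (surface F G) (surface F' G')"
    by (rule parallel_surface_has_normal_form) blast
next
  fix k l :: form and F G F' G' and T :: "real^4 \<Rightarrow> real^4"
  assume "k \<noteq> l" and forms: "has_form k F G" "has_form l F' G'"
    and "affine_transformation T" and "T 0 = 0"
  then obtain A :: "real^4^4" and b where "invertible A" and T: "T = (\<lambda>p. A *v p + b)"
    unfolding affine_transformation_def by blast
  moreover have "b = 0" using \<open>T 0 = 0\<close> T by simp
  ultimately show "\<not> maps_germ T (surface F G) (surface F' G')"
    using equivalent_forms_equal[OF forms] \<open>k \<noteq> l\<close> by auto
qed

end
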